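(* Let $\lambda$ be a nonzero real number. For every integer $n\ge 0$, \[ B_n(x)=\sum_{m=0}^n\sum_{k=m}^n\lambda^{k-m}S_2(k,m)\binom{n}{k}B_{n-k}\,b_{m,\lambda}(x)\;-\;n\sum_{m=0}^{n-1}\lambda^{n-m-1}S_2(n-1,m)\,b_{m,\lambda}(x). \]
   Context: For a nonzero real $\lambda$, the degenerate ordered Bell polynomials $b_{n,\lambda}(x)$ are defined by the formal power series identity \[ \frac{1}{2-(1+\lambda t)^{1/\lambda}}(1+\lambda t)^{x/\lambda}=\sum_{n=0}^\infty b_{n,\lambda}(x)\frac{t^n}{n!}, \] where $(1+\lambda t)^{a/\lambda}=\exp\big(\tfrac{a}{\lambda}\log(1+\lambda t)\big)$. The Bernoulli polynomials $B_n(x)$ are defined by $\frac{t}{e^t-1}e^{xt}=\sum_{n\ge 0}B_n(x)\frac{t^n}{n!}$ and $B_n=B_n(0)$. The Stirling numbers of the second kind $S_2(n,l)$ are defined by $x^n=\sum_{l=0}^n S_2(n,l)\,x(x-1)\cdots(x-l+1)$. For $n=0$ the second sum is empty. *)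

theory Defs
  imports Complex_Main
    "HOL-Computational_Algebra.Formal_Power_Series"
    "HOL-Combinatorics.Stirling"
begin

text \<open>
  Polynomials in \<open>x\<close> are represented by their values at real \<open>x\<close>; all power series are
  formal power series in \<open>t\<close>. In the library, \<open>fps_exp c\<close> is $e^{ct}$ and
  \<open>fps_ln 1\<close> is $\log(1+t)$.
\<close>

definition degenerate_exp :: "real \<Rightarrow> real \<Rightarrow> real fps" where
  \<comment> \<open>$(1+\lambda t)^{a/\lambda} = \exp(\frac{a}{\lambda}\log(1+\lambda t))$\<close>
  "degenerate_exp lam a =
     fps_exp 1 oo (fps_const (a / lam) * (fps_ln 1 oo (fps_const lam * fps_X)))"

definition degenerate_ordered_Bell :: "nat \<Rightarrow> real \<Rightarrow> real \<Rightarrow> real" where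
  "degenerate_ordered_Bell n lam x =
     fact n * fps_nth (1 / (2 - degenerate_exp lam 1) * degenerate_exp lam x) n"

definition Bernoulli_poly :: "nat \<Rightarrow> real \<Rightarrow> real" where
  "Bernoulli_poly n x = fact n * fps_nth (fps_X / (fps_exp 1 - 1) * fps_exp x) n"

definition Bernoulli_number :: "nat \<Rightarrow> real" where
  "Bernoulli_number n = Bernoulli_poly n 0"

text \<open>
  The power series quotients in the above definitions are genuine quotients, i.e. they do not
  depend on totalised division; hence the coefficients are those of the usual generating functions.
\<close>

lemma degenerate_exp_nth_0 [simp]: "fps_nth (degenerate_exp lam a) 0 = 1"
  by (simp add: degenerate_exp_def)

lemma degenerate_ordered_Bell_egf:
  "(2 - degenerate_exp lam 1) * Abs_fps (\<lambda>n. degenerate_ordered_Bell n lam x / fact n)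
     = degenerate_exp lam x"
proof -
  have "fps_nth (2 - degenerate_exp lam 1) 0 \<noteq> 0"
    by simp
  then have "(2 - degenerate_exp lam 1) * (1 / (2 - degenerate_exp lam 1)) = 1"
    by (simp add: fps_divide_unit inverse_mult_eq_1')
  moreover have "Abs_fps (\<lambda>n. degenerate_ordered_Bell n lam x / fact n)
      = 1 / (2 - degenerate_exp lam 1) * degenerate_exp lam x"
    by (rule fps_ext) (simp add: degenerate_ordered_Bell_def)
  ultimately show ?thesis
    by (simp only: mult.assoc [symmetric] mult_1)
qed

lemma Bernoulli_poly_egf:
  "(fps_exp 1 - 1) * Abs_fps (\<lambda>n. Bernoulli_poly n x / fact n) = fps_X * fps_exp x"
proof -
  have nz: "fps_nth (fps_exp 1 - 1 :: real fps) 1 \<noteq> 0"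
    by simp
  then have "fps_exp 1 - 1 \<noteq> (0 :: real fps)"
    by auto
  moreover have "subdegree (fps_exp 1 - 1 :: real fps) \<le> 1"
    using nz by (rule subdegree_leI)
  ultimately have "(fps_exp 1 - 1 :: real fps) dvd fps_X"
    by (simp add: fps_dvd_iff)
  then have "(fps_exp 1 - 1) * (fps_X / (fps_exp 1 - 1)) = (fps_X :: real fps)"
    by simp
  moreover have "Abs_fps (\<lambda>n. Bernoulli_poly n x / fact n) = fps_X / (fps_exp 1 - 1) * fps_exp x"
    by (rule fps_ext) (simp add: Bernoulli_poly_def)
  ultimately show ?thesis
    by (simp only: mult.assoc [symmetric])
qed

text \<open>
  The library defines \<open>Stirling\<close> by its recurrence; these are the coefficients of $x^n$ in the
  basis of falling factorials.
\<close>

lemma power_eq_sum_Stirling: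
  fixes x :: "'a :: comm_ring_1"
  shows "x ^ n = (\<Sum>l\<le>n. of_nat (Stirling n l) * (\<Prod>i<l. x - of_nat i))"
proof (induction n)
  case 0
  show ?case by simp
next
  case (Suc n)
  define F where "F l = (\<Prod>i<l. x - of_nat i)" for l
  have F: "x * F l = F (Suc l) + of_nat l * F l" for l
    by (simp add: F_def algebra_simps)
  have "x ^ Suc n = (\<Sum>l\<le>n. of_nat (Stirling n l) * (x * F l))"
    by (simp add: Suc F_def sum_distrib_left mult_ac)
  also have "\<dots> = (\<Sum>l\<le>n. of_nat (Stirling n l) * F (Suc l))
      + (\<Sum>l\<le>n. of_nat l * of_nat (Stirling n l) * F l)"
    by (simp add: F algebra_simps sum.distrib)
  also have "(\<Sum>l\<le>n. of_nat l * of_nat (Stirling n l) * F l)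
      = (\<Sum>l\<le>Suc n. of_nat l * of_nat (Stirling n l) * F l)"
    by simp
  also have "\<dots> = (\<Sum>l\<le>n. of_nat (Suc l) * of_nat (Stirling n (Suc l)) * F (Suc l))"
    by (subst sum.atMost_Suc_shift) simp
  also have "(\<Sum>l\<le>n. of_nat (Stirling n l) * F (Suc l)) + \<dots>
      = (\<Sum>l\<le>n. of_nat (Stirling (Suc n) (Suc l)) * F (Suc l))"
    by (simp add: algebra_simps sum.distrib)
  also have "\<dots> = (\<Sum>l\<le>Suc n. of_nat (Stirling (Suc n) l) * F l)"
    by (subst sum.atMost_Suc_shift) simp
  finally show ?case
    by (simp only: F_def)
qed

end

theory Submission
  imports Defs
begin

text \<open>
  Substituting \<open>t \<mapsto> (exp (\<lambda>t) - 1) / \<lambda>\<close> turns \<open>(1 + \<lambda>t)\<^sup>a\<^sup>/\<^sup>\<lambda>\<close> into \<open>exp (at)\<close>, hence the generating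
  function of the degenerate ordered Bell polynomials into \<open>C = exp (xt) / (2 - exp t)\<close>. The powers
  of the substituted series are generating functions of Stirling numbers, so
  \<open>C = \<Sum>\<^sub>k c\<^sub>k t\<^sup>k / k!\<close> with \<open>c\<^sub>k = \<Sum>\<^sub>m \<lambda>\<^sup>k\<^sup>-\<^sup>m S\<^sub>2(k,m) b\<^sub>m\<close>. Writing \<open>2 - exp t = 1 - (exp t - 1)\<close>,
  the theorem is the coefficient form of
  \<open>t exp (xt) / (exp t - 1) = t / (exp t - 1) \<cdot> C - t C\<close>.
\<close>

definition Stirling_series :: "real \<Rightarrow> real fps" where
  "Stirling_series lam = fps_const (1 / lam) * (fps_exp lam - 1)"

lemma Stirling_series_nth_0 [simp]: "fps_nth (Stirling_series lam) 0 = 0"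
  by (simp add: Stirling_series_def)

lemma fps_deriv_Stirling_series:
  assumes "lam \<noteq> 0"
  shows "fps_deriv (Stirling_series lam) = 1 + fps_const lam * Stirling_series lam"
proof (rule fps_ext)
  fix n
  show "fps_nth (fps_deriv (Stirling_series lam)) n
      = fps_nth (1 + fps_const lam * Stirling_series lam) n"
    using assms by (simp add: Stirling_series_def)
qed

text \<open>Induction on \<open>k\<close>. With E the series, E' = 1 + \<lambda> E yields (E^(j+1))'
  = (j+1) (E^j + \<lambda> E^(j+1)), which on coefficients is the recurrence S(k+1,j+1) = S(k,j) +
  (j+1) S(k,j+1).\<close>

lemma Stirling_series_power_nth:
  assumes "lam \<noteq> 0"
  shows "fps_nth (Stirling_series lam ^ m) k
    = fact m * lam ^ (k - m) * real (Stirling k m) / fact k"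
proof (induction k arbitrary: m)
  case 0
  show ?case by (cases m) (simp_all add: fps_mult_nth)
next
  case (Suc k)
  show ?case
  proof (cases m)
    case 0
    then show ?thesis by simp
  next
    case (Suc j)
    let ?E = "Stirling_series lam"
    have "fps_deriv (?E ^ Suc j)
        = fps_const (of_nat (Suc j)) * (?E ^ j + fps_const lam * ?E ^ Suc j)"
      unfolding fps_deriv_power fps_deriv_Stirling_series [OF assms]
      by (simp add: algebra_simps del: of_nat_Suc)
    from arg_cong [where f = "\<lambda>f. fps_nth f k", OF this]
    have "real (Suc k) * fps_nth (?E ^ Suc j) (Suc k)
        = real (Suc j) * (fps_nth (?E ^ j) k + lam * fps_nth (?E ^ Suc j) k)"
      by (simp del: of_nat_Suc power_Suc)
    also have "\<dots> = real (Suc j) * (fact j * lam ^ (k - j) * real (Stirling k j) / fact k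
        + fact (Suc j) * (lam * lam ^ (k - Suc j) * real (Stirling k (Suc j))) / fact k)"
      by (simp only: Suc.IH) (simp only: times_divide_eq_right mult_ac)
    \<comment> \<open>For \<open>k \<le> j\<close> the truncated exponents do not match, but then
      the Stirling number is 0.\<close>
    also have "lam * lam ^ (k - Suc j) * real (Stirling k (Suc j))
        = lam ^ (k - j) * real (Stirling k (Suc j))"
    proof (cases "j < k")
      case True
      then have "k - j = Suc (k - Suc j)" by simp
      then show ?thesis by simp
    qed simp
    also have "real (Suc j) * (fact j * lam ^ (k - j) * real (Stirling k j) / fact k
          + fact (Suc j) * (lam ^ (k - j) * real (Stirling k (Suc j))) / fact k)
        = fact (Suc j) * lam ^ (k - j) * real (Stirling (Suc k) (Suc j)) / fact k"
      by (simp add: field_simps)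
    finally show ?thesis
      by (simp add: Suc eq_divide_eq mult_ac del: of_nat_Suc power_Suc Stirling.simps)
  qed
qed

lemma degenerate_exp_compose_Stirling_series:
  assumes "lam \<noteq> 0"
  shows "degenerate_exp lam a oo Stirling_series lam = fps_exp a"
proof -
  let ?E = "Stirling_series lam"
  have inv: "fps_ln 1 oo (fps_exp 1 - 1) = (fps_X :: real fps)"
    by (simp add: fps_ln_fps_exp_inv fps_inv)
  \<comment> \<open>Writing \<lambda> E as exp(t) - 1 taken at \<lambda> t makes \<open>inv\<close>
    applicable: log(1 + \<lambda> E) = \<lambda> t.\<close>
  have "fps_const lam * fps_X oo ?E = fps_exp lam - 1"
    using assms by (simp add: fps_compose_mult_distrib Stirling_series_def mult.assoc [symmetric])
  also have "\<dots> = fps_exp 1 - 1 oo fps_const lam * fps_X"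
    by (simp add: fps_compose_sub_distrib)
  finally have "fps_ln 1 oo (fps_const lam * fps_X) oo ?E
      = fps_ln 1 oo (fps_exp 1 - 1 oo fps_const lam * fps_X)"
    by (simp add: fps_compose_assoc [symmetric])
  also have "\<dots> = fps_const lam * fps_X"
    by (simp add: fps_compose_assoc inv)
  finally have "fps_const (a / lam) * (fps_ln 1 oo (fps_const lam * fps_X)) oo ?E
      = fps_const a * fps_X"
    using assms by (simp add: fps_compose_mult_distrib mult.assoc [symmetric])
  then show ?thesis
    by (simp add: degenerate_exp_def fps_compose_assoc [symmetric])
qed

definition Stirling_transform_Bell :: "real \<Rightarrow> real \<Rightarrow> nat \<Rightarrow> real" where
  "Stirling_transform_Bell lam x k =
    (\<Sum>m\<le>k. lam ^ (k - m) * real (Stirling k m) * degenerate_ordered_Bell m lam x)"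

text \<open>Composition with a series without constant term respects products and differences, so
  the defining identity of the degenerate ordered Bell polynomials can be composed with
  \<open>Stirling_series lam\<close>. The m! in the coefficients of its m-th power cancels the one
  in the exponential generating function.\<close>

lemma Stirling_transform_Bell_egf:
  assumes "lam \<noteq> 0"
  shows "(2 - fps_exp 1) * Abs_fps (\<lambda>k. Stirling_transform_Bell lam x k / fact k) = fps_exp x"
proof -
  let ?G = "Abs_fps (\<lambda>n. degenerate_ordered_Bell n lam x / fact n)"
  let ?E = "Stirling_series lam"
  have "?G oo ?E = Abs_fps (\<lambda>k. Stirling_transform_Bell lam x k / fact k)"
    by (rule fps_ext)
      (simp add: fps_compose_nth Stirling_series_power_nth [OF assms] Stirling_transform_Bell_def
        sum_divide_distrib atLeast0AtMost mult_ac)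
  moreover have "(2 - degenerate_exp lam 1) * ?G oo ?E = fps_exp x"
    by (simp add: degenerate_ordered_Bell_egf degenerate_exp_compose_Stirling_series [OF assms])
  moreover have "(2 :: real fps) oo ?E = 2"
    by (metis fps_const_compose numeral_fps_const)
  ultimately show ?thesis
    by (simp add: fps_compose_mult_distrib fps_compose_sub_distrib
        degenerate_exp_compose_Stirling_series [OF assms])
qed

text \<open>Power series over the reals have no zero divisors, so it suffices to compare after
  multiplying by exp(t) - 1. The right side becomes t C - t (exp(t) - 1) C = t (2 - exp(t)) C = t
  exp(xt).\<close>

lemma Bernoulli_poly_Stirling_transform:
  assumes "lam \<noteq> 0"
  shows "Abs_fps (\<lambda>n. Bernoulli_poly n x / fact n)
    = Abs_fps (\<lambda>k. Stirling_transform_Bell lam x k / fact k)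
        * Abs_fps (\<lambda>n. Bernoulli_number n / fact n)
      - fps_X * Abs_fps (\<lambda>k. Stirling_transform_Bell lam x k / fact k)"
    (is "?P = ?C * ?B - fps_X * ?C")
proof -
  have nz: "fps_exp 1 - 1 \<noteq> (0 :: real fps)"
  proof
    assume "fps_exp 1 - 1 = (0 :: real fps)"
    from arg_cong [where f = "\<lambda>f. fps_nth f 1", OF this] show False by simp
  qed
  have B: "(fps_exp 1 - 1) * ?B = fps_X"
    using Bernoulli_poly_egf [of 0] by (simp add: Bernoulli_number_def)
  have "(fps_exp 1 - 1) * (?C * ?B - fps_X * ?C)
      = ?C * ((fps_exp 1 - 1) * ?B) - fps_X * ((fps_exp 1 - 1) * ?C)"
    by (simp add: algebra_simps)
  also have "\<dots> = fps_X * ((2 - fps_exp 1) * ?C)"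
    unfolding B by (simp add: algebra_simps)
  also have "\<dots> = (fps_exp 1 - 1) * ?P"
    by (simp only: Stirling_transform_Bell_egf [OF assms] Bernoulli_poly_egf)
  finally show ?thesis
    using nz by simp
qed

theorem theorem9:
  fixes lam x :: real and n :: nat
  assumes "lam \<noteq> 0"
  shows "Bernoulli_poly n x =
    (\<Sum>m=0..n. \<Sum>k=m..n. lam ^ (k - m) * real (Stirling k m) * real (n choose k)
        * Bernoulli_number (n - k) * degenerate_ordered_Bell m lam x)
    - real n * (\<Sum>m<n. lam ^ (n - m - 1) * real (Stirling (n - 1) m)
        * degenerate_ordered_Bell m lam x)"
proof -
  let ?c = "Stirling_transform_Bell lam x"
  let ?f = "\<lambda>k m. lam ^ (k - m) * real (Stirling k m) * real (n choose k)
        * Bernoulli_number (n - k) * degenerate_ordered_Bell m lam x"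
  \<comment> \<open>Both sides sum over the triangle \<open>m \<le> k \<le> n\<close>; swapping the
    pairs exchanges the order.\<close>
  have "(\<Sum>m=0..n. \<Sum>k=m..n. ?f k m) = (\<Sum>k\<le>n. \<Sum>m\<le>k. ?f k m)"
    unfolding sum.Sigma [OF finite_atLeastAtMost ballI [OF finite_atLeastAtMost]]
      sum.Sigma [OF finite_atMost ballI [OF finite_atMost]]
    by (rule sum.reindex_bij_witness [where i = prod.swap and j = prod.swap]) auto
  also have "\<dots> = (\<Sum>k\<le>n. real (n choose k) * ?c k * Bernoulli_number (n - k))"
    by (simp add: Stirling_transform_Bell_def sum_distrib_left sum_distrib_right mult_ac)
  finally have first: "(\<Sum>m=0..n. \<Sum>k=m..n. ?f k m)
      = (\<Sum>k\<le>n. real (n choose k) * ?c k * Bernoulli_number (n - k))" .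
  \<comment> \<open>At \<open>n = 0\<close> the truncated index \<open>n - 1\<close> is harmless,
    since the factor \<open>real n\<close> makes both sides 0.\<close>
  have second: "real n * (\<Sum>m<n. lam ^ (n - m - 1) * real (Stirling (n - 1) m)
        * degenerate_ordered_Bell m lam x) = real n * ?c (n - 1)"
    by (cases n) (simp_all add: Stirling_transform_Bell_def lessThan_Suc_atMost)
  \<comment> \<open>Compare coefficients of t^n: a Cauchy product, minus a series shifted by
    \<open>fps_X\<close>, whose constant term is 0.\<close>
  have "Bernoulli_poly n x / fact n
      = (\<Sum>k\<le>n. ?c k / fact k * (Bernoulli_number (n - k) / fact (n - k)))
        - (if n = 0 then 0 else ?c (n - 1) / fact (n - 1))"
    using arg_cong [where f = "\<lambda>f. fps_nth f n",
        OF Bernoulli_poly_Stirling_transform [OF assms, of x]]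
    unfolding fps_sub_nth fps_X_mult_nth
    by (simp only: fps_mult_nth fps_nth_Abs_fps atLeast0AtMost)
  then have "Bernoulli_poly n x
      = fact n * (\<Sum>k\<le>n. ?c k / fact k * (Bernoulli_number (n - k) / fact (n - k)))
        - fact n * (if n = 0 then 0 else ?c (n - 1) / fact (n - 1))"
    by (simp only: divide_eq_eq fact_nonzero if_True not_False_eq_True right_diff_distrib mult.commute)
  also have "fact n * (\<Sum>k\<le>n. ?c k / fact k * (Bernoulli_number (n - k) / fact (n - k)))
      = (\<Sum>k\<le>n. real (n choose k) * ?c k * Bernoulli_number (n - k))"
    unfolding sum_distrib_left by (rule sum.cong) (simp_all add: binomial_fact)
  also have "fact n * (if n = 0 then 0 else ?c (n - 1) / fact (n - 1)) = real n * ?c (n - 1)"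
    by (cases n) simp_all
  finally show ?thesis
    unfolding first second .
qed

end
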